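(* Let $R$ be a commutative ring with nonzero identity such that $O(R,2)\neq 0$ and let $n\ge 1$ be an integer. Then $\omega(TD(R,n))\geq 2^{[\frac{n}{2}]}-1$. If $n$ is an odd number, then $\omega(TD(R,n))\geq 2^{[\frac{n}{2}]}$.
   Context: For a commutative ring $R$ with nonzero identity and an integer $n\ge1$, $TD(R,n)$ is the simple graph with vertex set $R^n\setminus\{(0,\ldots,0)\}$ in which two distinct vertices $\mathbf{x},\mathbf{y}$ are adjacent if and only if $\mathbf{x}\cdot\mathbf{y}=\sum_{i=1}^n x_iy_i=0$ in $R$. $O(R,n)$ denotes the number of non-trivial (i.e. nonzero) solutions $(x_1,\ldots,x_n)\in R^n$ of $x_1^2+\cdots+x_n^2=0$. $\omega(G)$ is the clique number of $G$ (largest size of a set of pairwise adjacent vertices); $[\,\cdot\,]$ denotes the integer part. *)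

theory Defs
  imports "Jordan_Normal_Form.Matrix" "HOL-Library.Extended_Nat"
begin

text \<open>
  The ring \<open>R\<close> is the type \<open>'a :: comm_ring_1\<close>, a class whose axioms include \<open>0 \<noteq> 1\<close>.
  Vectors in \<open>R\<^sup>n\<close> are the elements of \<^term>\<open>carrier_vec n\<close>, indexed by \<open>0, \<dots>, n - 1\<close>.
\<close>

text \<open>
  \<open>R\<close> may be infinite, so cardinalities are taken in \<^typ>\<open>enat\<close>: \<^const>\<open>card\<close> alone would
  map infinite sets to \<open>0\<close>.
\<close>

definition ecard :: "'b set \<Rightarrow> enat" where
  "ecard A = (if finite A then enat (card A) else \<infinity>)"

text \<open>A simple graph is a pair of a vertex set and a set of two-element subsets of it.\<close>

type_synonym 'v graph = "'v set \<times> 'v set set"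

definition is_clique :: "'v graph \<Rightarrow> 'v set \<Rightarrow> bool" where
  "is_clique G C \<longleftrightarrow> C \<subseteq> fst G \<and> (\<forall>x\<in>C. \<forall>y\<in>C. x \<noteq> y \<longrightarrow> {x, y} \<in> snd G)"

text \<open>
  The supremum is a maximum unless the sizes of the cliques are unbounded, in which case it
  is \<open>\<infinity>\<close>.
\<close>

definition clique_number :: "'v graph \<Rightarrow> enat" where
  "clique_number G = (SUP C \<in> {C. is_clique G C}. ecard C)"

definition TD :: "'a :: comm_ring_1 itself \<Rightarrow> nat \<Rightarrow> 'a vec graph" where
  "TD R n = (let V = carrier_vec n - {0\<^sub>v n}
     in (V, {{x, y} | x y. x \<in> V \<and> y \<in> V \<and> x \<noteq> y \<and> x \<bullet> y = 0}))"

text \<open>\<open>O(R, n)\<close>, the number of nonzero solutions of \<open>x\<^sub>1\<^sup>2 + \<dots> + x\<^sub>n\<^sup>2 = 0\<close> in \<open>R\<^sup>n\<close>.\<close>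

definition num_sol :: "'a :: comm_ring_1 itself \<Rightarrow> nat \<Rightarrow> enat" where
  "num_sol R n = ecard {x :: 'a vec. x \<in> carrier_vec n \<and> x \<noteq> 0\<^sub>v n \<and> (\<Sum>i<n. (x $ i)\<^sup>2) = 0}"

end

theory Submission
  imports Defs
begin

text \<open>
  A nonzero solution \<open>(a, b)\<close> of \<open>x\<^sub>1\<^sup>2 + x\<^sub>2\<^sup>2 = 0\<close> is a vector orthogonal to itself.  Cut the
  coordinates into the \<open>m = n div 2\<close> blocks \<open>{2j, 2j + 1}\<close> and, for each set \<open>S\<close> of blocks, place a
  copy of \<open>(a, b)\<close> in every block of \<open>S\<close> and zeros elsewhere.  The inner product of the vectors of
  \<open>S\<close> and \<open>T\<close> is \<open>card (S \<inter> T) * (a\<^sup>2 + b\<^sup>2) = 0\<close>, and \<open>S\<close> can be read off from its vector because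
  \<open>(a, b) \<noteq> (0, 0)\<close>.  The \<open>2\<^sup>m - 1\<close> nonempty sets therefore give a clique.  If \<open>n\<close> is odd, the last
  coordinate lies in no block, so the unit vector at that coordinate extends the clique by one.
\<close>

lemma card_le_clique_number_TD:
  fixes C :: "'a :: comm_ring_1 vec set"
  assumes "finite C" and "C \<subseteq> carrier_vec n - {0\<^sub>v n}"
    and "\<And>x y. x \<in> C \<Longrightarrow> y \<in> C \<Longrightarrow> x \<noteq> y \<Longrightarrow> x \<bullet> y = 0"
  shows "enat (card C) \<le> clique_number (TD TYPE('a) n)"
proof -
  have "is_clique (TD TYPE('a) n) C"
    unfolding is_clique_def TD_def Let_def fst_conv snd_conv
  proof (intro conjI ballI impI)
    fix x y assume "x \<in> C" "y \<in> C" "x \<noteq> y"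
    then have "x \<in> carrier_vec n - {0\<^sub>v n}" "y \<in> carrier_vec n - {0\<^sub>v n}" "x \<bullet> y = 0"
      using assms(2) assms(3)[of x y] by (blast, blast, simp)
    with \<open>x \<noteq> y\<close> show "{x, y} \<in> {{x, y} | x y. x \<in> carrier_vec n - {0\<^sub>v n} \<and>
        y \<in> carrier_vec n - {0\<^sub>v n} \<and> x \<noteq> y \<and> x \<bullet> y = 0}"
      by (intro CollectI exI[of _ x] exI[of _ y]) simp
  qed (rule assms(2))
  then have "ecard C \<le> clique_number (TD TYPE('a) n)"
    unfolding clique_number_def by (intro SUP_upper) simp
  then show ?thesis
    using assms(1) by (simp add: ecard_def)
qed

lemma isotropic_pair_if_num_sol_nonzero:
  assumes "num_sol TYPE('a :: comm_ring_1) 2 \<noteq> 0"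
  obtains a b :: "'a :: comm_ring_1" where "a * a + b * b = 0" and "a \<noteq> 0 \<or> b \<noteq> 0"
proof -
  have "{x :: 'a vec. x \<in> carrier_vec 2 \<and> x \<noteq> 0\<^sub>v 2 \<and> (\<Sum>i<2. (x $ i)\<^sup>2) = 0} \<noteq> {}"
  proof
    assume "{x :: 'a vec. x \<in> carrier_vec 2 \<and> x \<noteq> 0\<^sub>v 2 \<and> (\<Sum>i<2. (x $ i)\<^sup>2) = 0} = {}"
    then have "num_sol TYPE('a) 2 = 0"
      unfolding num_sol_def by (simp only:) (simp add: ecard_def zero_enat_def)
    with assms show False by contradiction
  qed
  then obtain x :: "'a vec" where x: "x \<in> carrier_vec 2" "x \<noteq> 0\<^sub>v 2" "(\<Sum>i<2. (x $ i)\<^sup>2) = 0"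
    by blast
  have "x $ 0 \<noteq> 0 \<or> x $ 1 \<noteq> 0"
  proof (rule ccontr)
    assume "\<not> ?thesis"
    then have "x = 0\<^sub>v 2"
      using x(1) by (intro eq_vecI) (auto simp: less_2_cases_iff)
    with x(2) show False by contradiction
  qed
  moreover have "x $ 0 * x $ 0 + x $ 1 * x $ 1 = 0"
    using x(3) by (simp add: numeral_2_eq_2 lessThan_Suc power2_eq_square add.commute)
  ultimately show thesis
    using that by blast
qed

definition block_vec :: "'a :: comm_ring_1 \<Rightarrow> 'a \<Rightarrow> nat \<Rightarrow> nat set \<Rightarrow> 'a vec" where
  "block_vec a b n S = vec n (\<lambda>i. if i div 2 \<in> S then (if even i then a else b) else 0)"

lemma block_vec_carrier [simp]: "block_vec a b n S \<in> carrier_vec n"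
  by (simp add: block_vec_def)

lemma block_vec_empty [simp]: "block_vec a b n {} = 0\<^sub>v n"
  by (auto simp: block_vec_def)

lemma sum_pairs:
  fixes f :: "nat \<Rightarrow> 'a :: comm_monoid_add"
  shows "(\<Sum>i<2 * k. f i) = (\<Sum>j<k. f (2 * j) + f (2 * j + 1))"
  by (induction k) (simp_all add: add.assoc)

text \<open>
  For odd \<open>n\<close> the coordinate \<open>n - 1\<close> belongs to the incomplete block \<open>n div 2\<close>, which
  \<open>S \<subseteq> {..<n div 2}\<close> excludes: a lone \<open>a\<^sup>2\<close> there need not vanish.
\<close>

lemma block_vec_orthogonal:
  fixes a b :: "'a :: comm_ring_1"
  assumes "a * a + b * b = 0" and "S \<subseteq> {..<n div 2}"
  shows "block_vec a b n S \<bullet> block_vec a b n T = 0"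
proof -
  let ?f = "\<lambda>i. if i div 2 \<in> S \<inter> T then (if even i then a * a else b * b) else 0"
  have "block_vec a b n S \<bullet> block_vec a b n T = (\<Sum>i<n. ?f i)"
    unfolding scalar_prod_def block_vec_def by (auto simp: atLeast0LessThan intro!: sum.cong)
  also have "\<dots> = (\<Sum>i<2 * (n div 2). ?f i)"
  proof (intro sum.mono_neutral_right ballI)
    fix i assume "i \<in> {..<n} - {..<2 * (n div 2)}"
    then have "i div 2 \<notin> {..<n div 2}" by auto
    with assms(2) show "?f i = 0" by auto
  qed auto
  also have "\<dots> = (\<Sum>j<n div 2. 0)"
    unfolding sum_pairs using assms(1) by (intro sum.cong) auto
  finally show ?thesis by simp
qed

lemma block_vec_inj_on:
  fixes a b :: "'a :: comm_ring_1"
  assumes "a \<noteq> 0 \<or> b \<noteq> 0"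
  shows "inj_on (block_vec a b n) (Pow {..<n div 2})"
proof (rule inj_on_inverseI)
  fix S assume "S \<in> Pow {..<n div 2}"
  then show "{j. j < n div 2 \<and> (block_vec a b n S $ (2 * j) \<noteq> 0 \<or> block_vec a b n S $ (2 * j + 1) \<noteq> 0)} = S"
    using assms by (auto simp: block_vec_def split: if_splits)
qed

theorem theorem4p4:
  fixes n :: nat
  assumes "num_sol TYPE('a :: comm_ring_1) 2 \<noteq> 0"
    and "n \<ge> 1"
  shows "clique_number (TD TYPE('a) n) \<ge> enat (2 ^ (n div 2) - 1) \<and>
         (odd n \<longrightarrow> clique_number (TD TYPE('a) n) \<ge> enat (2 ^ (n div 2)))"
proof -
  obtain a b :: 'a where ab: "a * a + b * b = 0" "a \<noteq> 0 \<or> b \<noteq> 0"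
    using isotropic_pair_if_num_sol_nonzero[OF assms(1)] .
  let ?v = "block_vec a b n"
  let ?P = "Pow {..<n div 2} - {{}}"
  define C where "C = ?v ` ?P"
  have inj: "inj_on ?v (Pow {..<n div 2})"
    using ab(2) by (rule block_vec_inj_on)
  have fin: "finite C"
    by (simp add: C_def)
  have "card C = card ?P"
    unfolding C_def by (rule card_image, rule inj_on_subset[OF inj]) blast
  then have card: "card C = 2 ^ (n div 2) - 1"
    by (simp add: card_Diff_singleton card_Pow)
  have "?v S \<noteq> 0\<^sub>v n" if "S \<in> ?P" for S
    using inj_onD[OF inj, of S "{}"] that by auto
  then have C: "C \<subseteq> carrier_vec n - {0\<^sub>v n}"
    by (auto simp: C_def)
  have orth: "x \<bullet> y = 0" if "x \<in> C" "y \<in> C" for x y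
    using that ab(1) by (auto simp: C_def intro: block_vec_orthogonal)
  have "enat (2 ^ (n div 2) - 1) \<le> clique_number (TD TYPE('a) n)"
    using card_le_clique_number_TD[OF fin C] orth card by simp
  moreover have "enat (2 ^ (n div 2)) \<le> clique_number (TD TYPE('a) n)" if "odd n"
  proof -
    define e :: "'a vec" where "e = unit_vec n (n - 1)"
    have last: "n - 1 < n" "(n - 1) div 2 = n div 2"
      using assms(2) that by (auto elim: oddE)
    have e: "e \<in> carrier_vec n - {0\<^sub>v n}" "e $ (n - 1) = 1"
      using last(1) by (auto simp: e_def)
    have zero: "x $ (n - 1) = 0" if "x \<in> C" for x
      using that last by (auto simp: C_def block_vec_def split: if_splits)
    have "e \<notin> C"
      using zero e(2) by force
    moreover have "e \<bullet> x = 0 \<and> x \<bullet> e = 0" if "x \<in> C" for x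
    proof -
      have "x \<in> carrier_vec n"
        using that C by blast
      then show ?thesis
        using zero[OF that] last(1) by (simp add: e_def)
    qed
    ultimately have "enat (card (insert e C)) \<le> clique_number (TD TYPE('a) n)"
      using fin C e(1) orth by (intro card_le_clique_number_TD) auto
    then show ?thesis
      using \<open>e \<notin> C\<close> fin card by simp
  qed
  ultimately show ?thesis by blast
qed

end
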